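(* Let $w$ be the velocity trajectory, on $[0,\infty)$, of the system $J\dot w=-F+u$ with LuGre friction $$\dot z = w-\sigma_0\frac{|w|}{h(w)}z,\qquad F=\sigma_0 z+\sigma_1\dot z+F_v w,\qquad h(w)=F_c+(F_s-F_c)e^{-(w/w_s)^2},$$ for an arbitrary input $u$, and consider the observer $$\dot{\hat z}=w-\sigma_0\frac{|w|}{h(w)}\hat z+K_1(w-\hat w),\qquad J\dot{\hat w}=-\sigma_0\hat z-\sigma_1\dot{\hat z}-F_v w+u+K_2(w-\hat w).$$ Let $C>0$, $\alpha>0$, $\beta>0$ be arbitrary constants and choose the constant observer gains $$K_1=-\frac{2C(\sigma_1\alpha+\sigma_0)}{\beta J},\qquad K_3=-\frac{\sigma_1K_1}{J}+\alpha,\qquad K_2=JK_3+\sigma_1K_1=J\alpha .$$ Then the error dynamics for $e_z=z-\hat z$, $e_w=w-\hat w$, namely $$\dot e_z=-\sigma_0\frac{|w|}{h(w)}e_z-K_1e_w,\qquad \dot e_w=-\frac{\sigma_0}{J}e_z+\frac{\sigma_0\sigma_1}{J}\frac{|w|}{h(w)}e_z-K_3e_w,$$ is exponentially stable.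
   Context: All functions are real-valued functions of time $t\ge 0$. The constants $J$ (inertia), $\sigma_0$ (stiffness), $\sigma_1$ (damping), $F_c$ (Coulomb friction), $F_s$ (stiction), $w_s$ (Stribeck velocity) are positive, and $F_v$ (viscous coefficient) is a known constant. The velocity $w$ is measured; the internal state $z$ is not. The trajectories $w,z$ are assumed to exist on $[0,\infty)$. The error dynamics are a linear time-varying system with $w=w(t)$ regarded as a given signal. Exponential stability of such a system with state $e$ means: there exist $k,\delta>0$ such that every solution satisfies $\|e(t)\|\le k e^{-\delta(t-t_0)}\|e(t_0)\|$ for all $t\ge t_0\ge 0$. *)

theory Defs
  imports "HOL-Analysis.Analysis"
begin

text \<open>
  Two notions of solution of \<open>x' = f t x\<close> on \<open>[t0, \<infinity>)\<close>. The plant and the observer are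
  driven by an arbitrary input, possibly discontinuous, so their trajectories are understood
  in the integral (Caratheodory) sense, which includes the classical one. The error system
  contains no input and has continuous coefficients; its solutions are classical.
\<close>

definition classical_solution ::
    "(real \<Rightarrow> 'a \<Rightarrow> 'a) \<Rightarrow> real \<Rightarrow> (real \<Rightarrow> 'a::euclidean_space) \<Rightarrow> bool" where
  "classical_solution f t0 x \<longleftrightarrow>
     (\<forall>t\<ge>t0. (x has_vector_derivative f t (x t)) (at t within {t0..}))"

definition integral_solution ::
    "(real \<Rightarrow> 'a \<Rightarrow> 'a) \<Rightarrow> real \<Rightarrow> (real \<Rightarrow> 'a::euclidean_space) \<Rightarrow> bool" where
  "integral_solution f t0 x \<longleftrightarrow>
     (\<forall>t\<ge>t0. ((\<lambda>s. f s (x s)) has_integral (x t - x t0)) {t0..t})"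

lemma classical_imp_integral_solution:
  assumes "classical_solution f t0 x"
  shows "integral_solution f t0 x"
  unfolding integral_solution_def
proof (intro allI impI)
  fix t assume "t0 \<le> t"
  then show "((\<lambda>s. f s (x s)) has_integral (x t - x t0)) {t0..t}"
  proof (rule fundamental_theorem_of_calculus)
    fix s assume "s \<in> {t0..t}"
    with assms have "(x has_vector_derivative f s (x s)) (at s within {t0..})"
      by (simp add: classical_solution_def)
    then show "(x has_vector_derivative f s (x s)) (at s within {t0..t})"
      by (rule has_vector_derivative_within_subset) auto
  qed
qed

definition exponentially_stable :: "(real \<Rightarrow> 'a \<Rightarrow> 'a::euclidean_space) \<Rightarrow> bool" where
  "exponentially_stable f \<longleftrightarrow>
     (\<exists>k>0. \<exists>\<delta>>0. \<forall>t0\<ge>0. \<forall>e. classical_solution f t0 e \<longrightarrow>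
        (\<forall>t\<ge>t0. norm (e t) \<le> k * exp (- \<delta> * (t - t0)) * norm (e t0)))"

definition stribeck :: "real \<Rightarrow> real \<Rightarrow> real \<Rightarrow> real \<Rightarrow> real" where
  "stribeck Fc Fs ws w = Fc + (Fs - Fc) * exp (- (w / ws)\<^sup>2)"

text \<open>
  The vector fields below act on the pairs (internal state, velocity); \<open>h\<close> is the Stribeck
  function. The time derivative of the internal state occurring in the friction force is
  replaced by the right-hand side of its own equation.
\<close>

definition lugre_field ::
    "real \<Rightarrow> real \<Rightarrow> real \<Rightarrow> real \<Rightarrow> (real \<Rightarrow> real) \<Rightarrow> (real \<Rightarrow> real)
      \<Rightarrow> real \<Rightarrow> real \<times> real \<Rightarrow> real \<times> real" where
  "lugre_field J \<sigma>0 \<sigma>1 Fv h u t = (\<lambda>(z, w).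
     let zdot = w - \<sigma>0 * (\<bar>w\<bar> / h w) * z;
         F = \<sigma>0 * z + \<sigma>1 * zdot + Fv * w
     in (zdot, (- F + u t) / J))"

definition observer_field ::
    "real \<Rightarrow> real \<Rightarrow> real \<Rightarrow> real \<Rightarrow> (real \<Rightarrow> real) \<Rightarrow> (real \<Rightarrow> real) \<Rightarrow> real \<Rightarrow> real
      \<Rightarrow> (real \<Rightarrow> real) \<Rightarrow> real \<Rightarrow> real \<times> real \<Rightarrow> real \<times> real" where
  "observer_field J \<sigma>0 \<sigma>1 Fv h u K1 K2 w t = (\<lambda>(zh, wh).
     let zhdot = w t - \<sigma>0 * (\<bar>w t\<bar> / h (w t)) * zh + K1 * (w t - wh)
     in (zhdot,
         (- \<sigma>0 * zh - \<sigma>1 * zhdot - Fv * w t + u t + K2 * (w t - wh)) / J))"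

definition error_field ::
    "real \<Rightarrow> real \<Rightarrow> real \<Rightarrow> (real \<Rightarrow> real) \<Rightarrow> real \<Rightarrow> real
      \<Rightarrow> (real \<Rightarrow> real) \<Rightarrow> real \<Rightarrow> real \<times> real \<Rightarrow> real \<times> real" where
  "error_field J \<sigma>0 \<sigma>1 h K1 K3 w t = (\<lambda>(ez, ew).
     (- \<sigma>0 * (\<bar>w t\<bar> / h (w t)) * ez - K1 * ew,
      - (\<sigma>0 / J) * ez + (\<sigma>0 * \<sigma>1 / J) * (\<bar>w t\<bar> / h (w t)) * ez - K3 * ew))"

end

theory Submission
  imports Defs
begin

text \<open>
  With the coordinate \<open>q = J * e_w + \<sigma>1 * e_z\<close>, the quadratic form
  \<open>V = (\<sigma>1 * \<alpha> + \<sigma>0) * e_z\<^sup>2 - K1 / J * q\<^sup>2\<close> is positive definite because \<open>K1 < 0\<close>.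
  Along the error dynamics the mixed terms cancel and
  \<open>V' = 2 * K1 * (\<sigma>0 * \<sigma>1 / J * e_z\<^sup>2 + \<alpha> * J * e_w\<^sup>2) - 2 * (\<sigma>1 * \<alpha> + \<sigma>0) * \<sigma>0 * a * e_z\<^sup>2\<close>
  with \<open>a = \<bar>w\<bar> / h w \<ge> 0\<close>, so the decay rate does not depend on the signal \<open>w\<close>, which may be
  unbounded.
\<close>

section \<open>Regularity of integral solutions\<close>

lemma integral_solution_continuous_on:
  assumes "integral_solution f t0 x"
  shows "continuous_on {t0..} x"
proof -
  have "continuous_on {t0..b} x" for b
  proof (cases "t0 \<le> b")
    case True
    have int: "((\<lambda>s. f s (x s)) has_integral (x t - x t0)) {t0..t}" if "t \<ge> t0" for t
      using assms that by (simp add: integral_solution_def)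
    \<comment> \<open>The trajectory is its initial value plus an indefinite integral, so it is
      continuous even where the field jumps in time with the input.\<close>
    have "continuous_on {t0..b} (\<lambda>t. x t0 + integral {t0..t} (\<lambda>s. f s (x s)))"
      using int[OF True] by (intro continuous_intros indefinite_integral_continuous_1)
        (auto simp: has_integral_integrable)
    moreover have "x t0 + integral {t0..t} (\<lambda>s. f s (x s)) = x t" if "t \<in> {t0..b}" for t
      using int[of t] that by (simp add: integral_unique)
    ultimately show ?thesis by (rule continuous_on_eq)
  qed simp
  then have "continuous (at t within {t0..t+1}) x" if "t \<ge> t0" for t
    using that by (meson atLeastAtMost_iff continuous_on_eq_continuous_within less_add_one less_imp_le)
  \<comment> \<open>The extra unit to the right of \<open>t\<close> makes \<open>{t0..t+1}\<close>
    and \<open>{t0..}\<close> coincide near \<open>t\<close>, also at the left endpoint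
    \<open>t = t0\<close>.\<close>
  moreover have "at t within {t0..t+1} = at t within {t0..}" for t :: real
    by (rule at_within_nhd[of t "{..<t+1}"]) auto
  ultimately show ?thesis
    by (simp add: continuous_on_eq_continuous_within)
qed

text \<open>The fundamental theorem of calculus differentiates the integral equation once the
  integrand is continuous along the trajectory. This serves the error system, where the possibly
  discontinuous input has cancelled.\<close>

lemma integral_imp_classical_solution:
  assumes sol: "integral_solution f t0 x"
    and cont: "continuous_on {t0..} (\<lambda>t. f t (x t))"
  shows "classical_solution f t0 x"
  unfolding classical_solution_def
proof (intro allI impI)
  fix t assume t: "t0 \<le> t"
  have "((\<lambda>u. integral {t0..u} (\<lambda>s. f s (x s))) has_vector_derivative f t (x t))
          (at t within {t0..t+1})"
    using t by (intro integral_has_vector_derivative continuous_on_subset[OF cont]) auto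
  then have "((\<lambda>u. x t0 + integral {t0..u} (\<lambda>s. f s (x s))) has_vector_derivative f t (x t))
          (at t within {t0..t+1})"
    by (auto intro!: derivative_eq_intros)
  then have "(x has_vector_derivative f t (x t)) (at t within {t0..t+1})"
  proof (rule has_vector_derivative_transform[rotated 2])
    show "x u = x t0 + integral {t0..u} (\<lambda>s. f s (x s))" if "u \<in> {t0..t+1}" for u
      using sol that integral_unique[of "\<lambda>s. f s (x s)" "x u - x t0" "{t0..u}"]
      by (simp add: integral_solution_def)
  qed (use t in auto)
  moreover have "at t within {t0..t+1} = at t within {t0..}"
    by (rule at_within_nhd[of t "{..<t+1}"]) auto
  ultimately show "(x has_vector_derivative f t (x t)) (at t within {t0..})"
    by simp
qed

section \<open>Exponential decay from quadratic Lyapunov functions\<close>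

lemma exponential_decay:
  fixes v v' :: "real \<Rightarrow> real"
  assumes deriv: "\<And>s. s \<ge> t0 \<Longrightarrow> (v has_real_derivative v' s) (at s within {t0..})"
    and le: "\<And>s. s \<ge> t0 \<Longrightarrow> v' s \<le> - c * v s"
    and t: "t \<ge> t0"
  shows "v t \<le> exp (- c * (t - t0)) * v t0"
proof -
  \<comment> \<open>Integrating factor: the differential inequality says exactly that
    \<open>g\<close> is nonincreasing.\<close>
  define g where "g s = exp (c * (s - t0)) * v s" for s
  have g': "(g has_real_derivative exp (c * (s - t0)) * (c * v s + v' s)) (at s within {t0..})"
    if "s \<ge> t0" for s
    unfolding g_def using deriv[OF that]
    by (auto intro!: derivative_eq_intros simp: algebra_simps)
  have "g t \<le> g t0"
  \<comment> \<open>At \<open>t0\<close> only a one-sided derivative is available, hence derivatives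
    on the open interval and continuity on the closed one.\<close>
  proof (rule DERIV_nonpos_imp_decreasing_open[OF t])
    fix s assume s: "t0 < s" "s < t"
    have "at s within {t0..} = at s"
      using s by (intro at_within_interior) auto
    then have "(g has_real_derivative exp (c * (s - t0)) * (c * v s + v' s)) (at s)"
      using g'[of s] s by simp
    moreover have "exp (c * (s - t0)) * (c * v s + v' s) \<le> 0"
      using le[of s] s by (intro mult_nonneg_nonpos) auto
    ultimately show "\<exists>y. (g has_real_derivative y) (at s) \<and> y \<le> 0" by blast
  next
    have "continuous_on {t0..} g"
      using g' by (auto simp: continuous_on_eq_continuous_within intro: DERIV_continuous)
    then show "continuous_on {t0..t} g"
      by (rule continuous_on_subset) auto
  qed
  then have "exp (- c * (t - t0)) * g t \<le> exp (- c * (t - t0)) * v t0"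
    by (simp add: g_def)
  moreover have "exp (- c * (t - t0)) * g t = v t"
    by (simp add: g_def mult.assoc[symmetric] exp_add[symmetric])
  ultimately show ?thesis by (simp only:)
qed

text \<open>\<open>V\<close> does not depend on time and its decay estimate is uniform in
  \<open>t\<close>, so the resulting constants are independent of \<open>t0\<close> and of the
  solution, as exponential stability demands.\<close>

lemma exponentially_stable_lyapunov:
  fixes V :: "'a::euclidean_space \<Rightarrow> real"
  assumes pos: "m > 0" "M > 0" "c > 0"
    and lower: "\<And>x. m * (norm x)\<^sup>2 \<le> V x"
    and upper: "\<And>x. V x \<le> M * (norm x)\<^sup>2"
    and deriv: "\<And>x. (V has_derivative V' x) (at x)"
    and decay: "\<And>t x. t \<ge> 0 \<Longrightarrow> V' x (f t x) \<le> - c * (norm x)\<^sup>2"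
  shows "exponentially_stable f"
  unfolding exponentially_stable_def
proof (intro exI conjI allI impI)
  \<comment> \<open>The upper bound turns \<open>decay\<close> into the rate \<open>c / M\<close>
    for \<open>V\<close>. Returning to the squared norm costs the factor \<open>M / m\<close>; the
    final square root also halves the rate.\<close>
  show "sqrt (M / m) > 0" "c / (2 * M) > 0" using pos by auto
  fix t0 e t
  assume t0: "0 \<le> t0" and sol: "classical_solution f t0 e" and t: "t0 \<le> t"
  have "V (e t) \<le> exp (- (c / M) * (t - t0)) * V (e t0)"
  proof (rule exponential_decay[OF _ _ t])
    fix s assume s: "t0 \<le> s"
    have "(e has_derivative (\<lambda>h. h *\<^sub>R f s (e s))) (at s within {t0..})"
      using sol s by (simp add: classical_solution_def has_vector_derivative_def)
    from has_derivative_compose[OF this deriv]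
    have "((\<lambda>s. V (e s)) has_derivative (\<lambda>h. V' (e s) (h *\<^sub>R f s (e s)))) (at s within {t0..})" .
    moreover have "V' (e s) (h *\<^sub>R f s (e s)) = V' (e s) (f s (e s)) * h" for h
      using linear_scale[OF has_derivative_linear[OF deriv]] by simp
    ultimately show "((\<lambda>s. V (e s)) has_real_derivative V' (e s) (f s (e s))) (at s within {t0..})"
      by (simp add: has_field_derivative_def)
    have "V' (e s) (f s (e s)) \<le> - (c / M) * (M * (norm (e s))\<^sup>2)"
      using decay[of s "e s"] s t0 pos by simp
    also have "\<dots> \<le> - (c / M) * V (e s)"
      using upper[of "e s"] pos by (intro mult_left_mono_neg) auto
    finally show "V' (e s) (f s (e s)) \<le> - (c / M) * V (e s)" .
  qed
  also have "\<dots> \<le> exp (- (c / M) * (t - t0)) * (M * (norm (e t0))\<^sup>2)"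
    using upper by simp
  finally have "m * (norm (e t))\<^sup>2 \<le> exp (- (c / M) * (t - t0)) * (M * (norm (e t0))\<^sup>2)"
    using lower[of "e t"] by linarith
  then have "(norm (e t))\<^sup>2 \<le> M / m * exp (- (c / M) * (t - t0)) * (norm (e t0))\<^sup>2"
    using pos by (simp add: field_simps)
  also have "\<dots> = (sqrt (M / m) * exp (- (c / (2 * M)) * (t - t0)) * norm (e t0))\<^sup>2"
  proof -
    have "exp (- (c / M) * (t - t0)) = (exp (- (c / (2 * M)) * (t - t0)))\<^sup>2"
      unfolding exp_double[symmetric] by simp
    then show ?thesis
      using pos by (simp only: power_mult_distrib) simp
  qed
  finally show "norm (e t) \<le> sqrt (M / m) * exp (- (c / (2 * M)) * (t - t0)) * norm (e t0)"
    by (rule power2_le_imp_le) (use pos in simp)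
qed

section \<open>The Stribeck function and the observer error system\<close>

lemma stribeck_pos:
  assumes "Fc > 0" "Fs > 0"
  shows "stribeck Fc Fs ws w > 0"
proof -
  define E where "E = exp (- (w / ws)\<^sup>2)"
  have "0 < E" "E \<le> 1" by (auto simp: E_def)
  \<comment> \<open>The Stribeck function is a convex combination of \<open>Fc\<close> and
    \<open>Fs\<close>, so the order of these two constants does not matter.\<close>
  then have "Fc * (1 - E) + Fs * E > 0"
    using assms by (intro add_nonneg_pos) auto
  then show ?thesis by (simp add: stribeck_def E_def algebra_simps)
qed

lemma continuous_on_stribeck [continuous_intros]:
  "continuous_on S g \<Longrightarrow> continuous_on S (\<lambda>t. stribeck Fc Fs ws (g t))"
  unfolding stribeck_def divide_inverse by (intro continuous_intros)

text \<open>Subtracting the integral equations cancels \<open>u\<close> and the viscous term,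
  because both fields use the same measured \<open>w\<close>. The velocity error is left with
  coefficient \<open>(\<sigma>1 * K1 - K2) / J\<close>, which the choice of \<open>K2\<close> makes
  \<open>- K3\<close>.\<close>

lemma error_integral_solution:
  assumes plant: "integral_solution (lugre_field J \<sigma>0 \<sigma>1 Fv h u) t0 (\<lambda>t. (z t, w t))"
    and obs: "integral_solution (observer_field J \<sigma>0 \<sigma>1 Fv h u K1 K2 w) t0 (\<lambda>t. (zh t, wh t))"
    and J: "J \<noteq> 0" and K2: "K2 = J * K3 + \<sigma>1 * K1"
  shows "integral_solution (error_field J \<sigma>0 \<sigma>1 h K1 K3 w) t0 (\<lambda>t. (z t - zh t, w t - wh t))"
  unfolding integral_solution_def
proof (intro allI impI)
  fix t assume t: "t0 \<le> t"
  have field: "lugre_field J \<sigma>0 \<sigma>1 Fv h u s (z s, w s)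
          - observer_field J \<sigma>0 \<sigma>1 Fv h u K1 K2 w s (zh s, wh s)
        = error_field J \<sigma>0 \<sigma>1 h K1 K3 w s (z s - zh s, w s - wh s)" for s
  proof -
    \<comment> \<open>Keeping the quotient as an atom prevents simplification from clearing the
      denominator \<open>h (w s)\<close>, which may vanish here.\<close>
    define a where "a = \<bar>w s\<bar> / h (w s)"
    show ?thesis
      unfolding lugre_field_def observer_field_def error_field_def K2 Let_def prod.case
        a_def[symmetric]
      using J by (simp add: field_simps)
  qed
  have "((z t, w t) - (z t0, w t0)) - ((zh t, wh t) - (zh t0, wh t0))
      = (z t - zh t, w t - wh t) - (z t0 - zh t0, w t0 - wh t0)"
    by simp
  with has_integral_diff[OF plant[unfolded integral_solution_def, rule_format, OF t]
      obs[unfolded integral_solution_def, rule_format, OF t]]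
  show "((\<lambda>s. error_field J \<sigma>0 \<sigma>1 h K1 K3 w s (z s - zh s, w s - wh s))
      has_integral ((z t - zh t, w t - wh t) - (z t0 - zh t0, w t0 - wh t0))) {t0..t}"
    by (simp only: field)
qed

lemma error_classical_solution:
  assumes plant: "integral_solution (lugre_field J \<sigma>0 \<sigma>1 Fv h u) t0 (\<lambda>t. (z t, w t))"
    and obs: "integral_solution (observer_field J \<sigma>0 \<sigma>1 Fv h u K1 K2 w) t0 (\<lambda>t. (zh t, wh t))"
    and J: "J \<noteq> 0" and K2: "K2 = J * K3 + \<sigma>1 * K1"
    and h: "continuous_on UNIV h" "\<And>v. h v \<noteq> 0"
  shows "classical_solution (error_field J \<sigma>0 \<sigma>1 h K1 K3 w) t0 (\<lambda>t. (z t - zh t, w t - wh t))"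
proof (rule integral_imp_classical_solution[OF error_integral_solution[OF plant obs J K2]])
  note c = integral_solution_continuous_on[OF plant] integral_solution_continuous_on[OF obs]
  have [continuous_intros]: "continuous_on {t0..} z" "continuous_on {t0..} w"
      "continuous_on {t0..} zh" "continuous_on {t0..} wh"
    using c[THEN continuous_on_fst] c[THEN continuous_on_snd] by simp_all
  have [continuous_intros]: "continuous_on {t0..} (\<lambda>t. h (w t))"
    by (rule continuous_on_compose2[OF h(1)]) (simp_all add: \<open>continuous_on {t0..} w\<close>)
  show "continuous_on {t0..}
      (\<lambda>t. error_field J \<sigma>0 \<sigma>1 h K1 K3 w t (z t - zh t, w t - wh t))"
    unfolding error_field_def prod.case by (intro continuous_intros) (auto simp: h J)
qed

text \<open>Along the error dynamics \<open>q\<close> has derivative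
  \<open>- \<sigma>0 * e_z - \<alpha> * J * e_w\<close>: the terms containing
  \<open>\<bar>w\<bar> / h w\<close> cancel, and \<open>K3\<close> is tuned so that
  \<open>J * K3 + \<sigma>1 * K1 = \<alpha> * J\<close>.\<close>

lemma error_exponentially_stable:
  assumes pos: "J > 0" "\<sigma>0 > 0" "\<sigma>1 > 0" "\<alpha> > 0" and K1: "K1 < 0"
    and K3: "K3 = - (\<sigma>1 * K1) / J + \<alpha>"
    and h: "\<And>v. h v > 0"
  shows "exponentially_stable (error_field J \<sigma>0 \<sigma>1 h K1 K3 w)"
proof -
  define p where "p = - K1"
  define l where "l = \<sigma>1 * \<alpha> + \<sigma>0"
  define V :: "real \<times> real \<Rightarrow> real"
    where "V x = l * (fst x)\<^sup>2 + p / J * (J * snd x + \<sigma>1 * fst x)\<^sup>2" for x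
  define V' :: "real \<times> real \<Rightarrow> real \<times> real \<Rightarrow> real"
    where "V' x d = 2 * l * fst x * fst d
      + 2 * p / J * (J * snd x + \<sigma>1 * fst x) * (J * snd d + \<sigma>1 * fst d)" for x d
  \<comment> \<open>\<open>N\<close> and \<open>M\<close> are sums of the coefficients in the two
    norm comparisons below, hence dominate each of them; \<open>c\<close> is the smaller of the two
    dissipation coefficients in \<open>V'\<close>.\<close>
  define N where "N = (1 + 2 * \<sigma>1\<^sup>2 / J\<^sup>2) / l + 2 / (p * J)"
  define M where "M = l + 2 * p * \<sigma>1\<^sup>2 / J + 2 * p * J"
  define c where "c = 2 * p * min (\<sigma>0 * \<sigma>1 / J) (\<alpha> * J)"
  have p: "p > 0" using K1 by (simp add: p_def)
  have l: "l > 0" using pos by (simp add: l_def add_pos_pos)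
  have N: "N > 0" using pos p l by (simp add: N_def add_pos_pos add_pos_nonneg)
  have M: "M > 0" using pos p l by (simp add: M_def add_pos_pos)
  have c: "c > 0" using pos p by (simp add: c_def)
  have norm: "(norm x)\<^sup>2 = (fst x)\<^sup>2 + (snd x)\<^sup>2" for x :: "real \<times> real"
    by (cases x) (simp add: norm_Pair)
  show ?thesis
  proof (rule exponentially_stable_lyapunov[of "1 / N" M c V V'])
    show "1 / N > 0" "M > 0" "c > 0" using N M c by auto
  next
    fix x :: "real \<times> real"
    define y q where "y = fst x" and "q = J * snd x + \<sigma>1 * fst x"
    have "snd x = (q - \<sigma>1 * y) / J" using pos by (simp add: y_def q_def)
    then have "(snd x)\<^sup>2 = (q - \<sigma>1 * y)\<^sup>2 / J\<^sup>2" by (simp add: power_divide)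
    \<comment> \<open>The gap between the numerators is the square of
      \<open>q + \<sigma>1 * y\<close>; the upper bound below uses the same inequality with the
      opposite sign.\<close>
    also have "\<dots> \<le> (2 * q\<^sup>2 + 2 * (\<sigma>1 * y)\<^sup>2) / J\<^sup>2"
      using zero_le_power2[of "q + \<sigma>1 * y"]
      by (intro divide_right_mono) (auto simp: power2_eq_square algebra_simps)
    finally have "(norm x)\<^sup>2 \<le> y\<^sup>2 + (2 * q\<^sup>2 + 2 * (\<sigma>1 * y)\<^sup>2) / J\<^sup>2"
      by (simp add: norm y_def)
    also have "\<dots> = (1 + 2 * \<sigma>1\<^sup>2 / J\<^sup>2) / l * (l * y\<^sup>2) + 2 / (p * J) * (p / J * q\<^sup>2)"
      using pos p l by (simp add: field_simps power2_eq_square)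
    also have "\<dots> \<le> N * (l * y\<^sup>2) + N * (p / J * q\<^sup>2)"
      using pos p l by (intro add_mono mult_right_mono) (auto simp: N_def)
    also have "\<dots> = N * V x" by (simp add: V_def y_def q_def algebra_simps)
    finally show "1 / N * (norm x)\<^sup>2 \<le> V x" using N by (simp add: field_simps)
  next
    fix x :: "real \<times> real"
    define y v where "y = fst x" and "v = snd x"
    have "(J * v + \<sigma>1 * y)\<^sup>2 \<le> 2 * (J * v)\<^sup>2 + 2 * (\<sigma>1 * y)\<^sup>2"
      using zero_le_power2[of "J * v - \<sigma>1 * y"] by (simp add: power2_eq_square algebra_simps)
    then have "V x \<le> l * y\<^sup>2 + p / J * (2 * (J * v)\<^sup>2 + 2 * (\<sigma>1 * y)\<^sup>2)"
      unfolding V_def y_def v_def using pos p by (intro add_left_mono mult_left_mono) auto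
    also have "\<dots> = (l + 2 * p * \<sigma>1\<^sup>2 / J) * y\<^sup>2 + 2 * p * J * v\<^sup>2"
      using pos by (simp add: field_simps power2_eq_square)
    also have "\<dots> \<le> M * y\<^sup>2 + M * v\<^sup>2"
      using pos p l by (intro add_mono mult_right_mono) (auto simp: M_def)
    finally show "V x \<le> M * (norm x)\<^sup>2" by (simp add: norm y_def v_def algebra_simps)
  next
    fix x :: "real \<times> real"
    show "(V has_derivative V' x) (at x)"
      unfolding V_def V'_def using pos
      by (auto intro!: derivative_eq_intros simp: field_simps power2_eq_square)
  next
    fix t and x :: "real \<times> real"
    define y v a where "y = fst x" and "v = snd x" and "a = \<bar>w t\<bar> / h (w t)"
    have a: "a \<ge> 0" using h[of "w t"] by (simp add: a_def)
    have x: "x = (y, v)" by (simp add: y_def v_def)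
    \<comment> \<open>The first square contributes \<open>2 * l * p\<close> to the coefficient of
      \<open>y * v\<close>, the second \<open>- 2 * p * (\<sigma>1 * \<alpha> + \<sigma>0)\<close>;
      the weight \<open>l\<close> is chosen to cancel them.\<close>
    have "V' x (error_field J \<sigma>0 \<sigma>1 h K1 K3 w t x)
        = - 2 * p * (\<sigma>0 * \<sigma>1 / J) * y\<^sup>2 - 2 * p * (\<alpha> * J) * v\<^sup>2 - 2 * l * \<sigma>0 * a * y\<^sup>2"
      using pos unfolding x V'_def error_field_def K3 a_def[symmetric] prod.case fst_conv snd_conv
      by (simp add: p_def l_def field_simps power2_eq_square)
    also have "\<dots> \<le> - 2 * p * (\<sigma>0 * \<sigma>1 / J) * y\<^sup>2 - 2 * p * (\<alpha> * J) * v\<^sup>2"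
      using a pos l by simp
    also have "\<dots> \<le> - c * y\<^sup>2 - c * v\<^sup>2"
    proof -
      have "c * y\<^sup>2 \<le> 2 * p * (\<sigma>0 * \<sigma>1 / J) * y\<^sup>2" "c * v\<^sup>2 \<le> 2 * p * (\<alpha> * J) * v\<^sup>2"
        unfolding c_def using p by (intro mult_right_mono mult_left_mono; simp)+
      then show ?thesis by simp
    qed
    finally show "V' x (error_field J \<sigma>0 \<sigma>1 h K1 K3 w t x) \<le> - c * (norm x)\<^sup>2"
      by (simp add: norm y_def v_def algebra_simps)
  qed
qed

theorem lemma6:
  fixes J \<sigma>0 \<sigma>1 Fc Fs Fv ws C \<alpha> \<beta> K1 K2 K3 :: real
    and u z w :: "real \<Rightarrow> real"
  assumes "J > 0" "\<sigma>0 > 0" "\<sigma>1 > 0" "Fc > 0" "Fs > 0" "ws > 0"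
    and "C > 0" "\<alpha> > 0" "\<beta> > 0"
    and "integral_solution (lugre_field J \<sigma>0 \<sigma>1 Fv (stribeck Fc Fs ws) u) 0 (\<lambda>t. (z t, w t))"
    and "K1 = - (2 * C * (\<sigma>1 * \<alpha> + \<sigma>0)) / (\<beta> * J)"
    and "K3 = - (\<sigma>1 * K1) / J + \<alpha>"
    and "K2 = J * K3 + \<sigma>1 * K1"
  shows "K2 = J * \<alpha> \<and>
         (\<forall>zh wh. integral_solution
             (observer_field J \<sigma>0 \<sigma>1 Fv (stribeck Fc Fs ws) u K1 K2 w) 0 (\<lambda>t. (zh t, wh t)) \<longrightarrow>
           classical_solution
             (error_field J \<sigma>0 \<sigma>1 (stribeck Fc Fs ws) K1 K3 w) 0 (\<lambda>t. (z t - zh t, w t - wh t))) \<and>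
         exponentially_stable (error_field J \<sigma>0 \<sigma>1 (stribeck Fc Fs ws) K1 K3 w)"
proof (intro conjI allI impI)
  have h: "stribeck Fc Fs ws v > 0" for v
    using assms(4,5) by (rule stribeck_pos)
  show "K2 = J * \<alpha>"
    using assms(1,12,13) by (simp add: field_simps)
  show "classical_solution
      (error_field J \<sigma>0 \<sigma>1 (stribeck Fc Fs ws) K1 K3 w) 0 (\<lambda>t. (z t - zh t, w t - wh t))"
    if "integral_solution
      (observer_field J \<sigma>0 \<sigma>1 Fv (stribeck Fc Fs ws) u K1 K2 w) 0 (\<lambda>t. (zh t, wh t))" for zh wh
    by (rule error_classical_solution[OF assms(10) that _ assms(13)])
      (use assms(1) h in \<open>auto intro!: continuous_on_stribeck simp: less_imp_neq[symmetric]\<close>)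
  \<comment> \<open>\<open>C\<close> and \<open>\<beta>\<close> enter the stability argument only
    through this sign.\<close>
  have "K1 < 0"
    using assms(1-3,7-9) unfolding assms(11) by (simp add: divide_neg_pos add_pos_pos)
  then show "exponentially_stable (error_field J \<sigma>0 \<sigma>1 (stribeck Fc Fs ws) K1 K3 w)"
    by (rule error_exponentially_stable[OF assms(1-3,8) _ assms(12) h])
qed

end
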